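(* Let $(X,T)$ be a topological dynamical system. Then the following conditions are equivalent: (1) $(X,T)$ is transitive and has dense small periodic sets. (2) $Trans_{b\mathcal F_{wt}}(X,T)=Trans(X,T)\neq\emptyset$. (3) $(X,T)$ is $b\mathcal F_{wt}$-point transitive.
   Context: A topological dynamical system is a pair $(X,T)$ with $X$ a nonempty compact metric space and $T:X\to X$ continuous. "Opene" means nonempty open. For opene $U,V\subset X$ and $x\in X$: $N(U,V)=\{n\in\mathbb Z_+: U\cap T^{-n}V\ne\emptyset\}$, $N(x,U)=\{n\in\mathbb Z_+: T^nx\in U\}$. $(X,T)$ is transitive if $N(U,V)$ is infinite for all opene $U,V$. A transitive point is an $x\in X$ whose $\omega$-limit set $\omega(x,T)$ is $X$ (equivalently, $N(x,U)$ is infinite for every opene $U$); $Trans(X,T)$ is the set of transitive points. $(X,T)$ has dense small periodic sets if for every opene $U\subset X$ there are a nonempty closed set $Y\subset U$ and $k\in\mathbb N$ with $T^kY\subset Y$. $F\subset\mathbb Z_+$ is thick if for every $n\in\mathbb N$ there is $a_n\in\mathbb Z_+$ with $[a_n,a_n+n]\subset F$; it is weakly thick if there is $k\in\mathbb N$ such that $\{n\in\mathbb Z_+: kn\in F\}$ is thick. $\mathcal F_{wt}$ is the family of weakly thick sets. For a family $\mathcal F$ (an upward hereditary collection of subsets of $\mathbb Z_+$), the block family $b\mathcal F$ consists of all $F\subset\mathbb Z_+$ for which there is $F'\in\mathcal F$ such that for every finite $W\subset F'$ there is $m\in\mathbb Z_+$ with $m+W\subset F$. A point $x\in X$ is an $\mathcal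 F$-transitive point if $N(x,U)\in\mathcal F$ for every opene $U$; the set of these is $Trans_{\mathcal F}(X,T)$, and $(X,T)$ is $\mathcal F$-point transitive if this set is nonempty. *)

theory Defs
  imports "HOL-Analysis.Analysis"
begin

text \<open>
  The phase space is a subset \<open>X\<close> of an arbitrary metric space type, and all topological notions
  are relative to \<open>X\<close>. The values of \<open>T\<close> outside \<open>X\<close> are irrelevant.
  The nonnegative integers are modelled by \<^typ>\<open>nat\<close>, and ``$k$ is a natural number'' by \<open>0 < k\<close>.
\<close>

definition tds :: "'a::metric_space set \<Rightarrow> ('a \<Rightarrow> 'a) \<Rightarrow> bool" where
  "tds X T \<longleftrightarrow> X \<noteq> {} \<and> compact X \<and> continuous_on X T \<and> T ` X \<subseteq> X"

definition opene :: "'a::metric_space set \<Rightarrow> 'a set \<Rightarrow> bool" where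
  "opene X U \<longleftrightarrow> openin (top_of_set X) U \<and> U \<noteq> {}"

definition hit_sets :: "'a set \<Rightarrow> ('a \<Rightarrow> 'a) \<Rightarrow> 'a set \<Rightarrow> 'a set \<Rightarrow> nat set" where
  "hit_sets X T U V = {n. U \<inter> {x \<in> X. (T ^^ n) x \<in> V} \<noteq> {}}"

definition hit_point :: "('a \<Rightarrow> 'a) \<Rightarrow> 'a \<Rightarrow> 'a set \<Rightarrow> nat set" where
  "hit_point T x U = {n. (T ^^ n) x \<in> U}"

definition transitive_tds :: "'a::metric_space set \<Rightarrow> ('a \<Rightarrow> 'a) \<Rightarrow> bool" where
  "transitive_tds X T \<longleftrightarrow>
     (\<forall>U V. opene X U \<longrightarrow> opene X V \<longrightarrow> infinite (hit_sets X T U V))"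

text \<open>
  Limit points are those of the sequence of iterates, not accumulation points of the orbit as a
  set; on a periodic orbit the two differ. For compact \<open>X\<close> and a point of \<open>X\<close>, the closure in
  the ambient type agrees with the closure in \<open>X\<close>.
\<close>

definition omega_limit :: "('a::metric_space \<Rightarrow> 'a) \<Rightarrow> 'a \<Rightarrow> 'a set" where
  "omega_limit T x = (\<Inter>m. closure {(T ^^ n) x | n. m \<le> n})"

definition Trans :: "'a::metric_space set \<Rightarrow> ('a \<Rightarrow> 'a) \<Rightarrow> 'a set" where
  "Trans X T = {x \<in> X. omega_limit T x = X}"

definition dense_small_periodic_sets :: "'a::metric_space set \<Rightarrow> ('a \<Rightarrow> 'a) \<Rightarrow> bool" where
  "dense_small_periodic_sets X T \<longleftrightarrow>
     (\<forall>U. opene X U \<longrightarrow>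
        (\<exists>Y k. Y \<noteq> {} \<and> closedin (top_of_set X) Y \<and> Y \<subseteq> U \<and> 0 < k \<and> (T ^^ k) ` Y \<subseteq> Y))"

definition thick :: "nat set \<Rightarrow> bool" where
  "thick F \<longleftrightarrow> (\<forall>n>0. \<exists>a. {a..a + n} \<subseteq> F)"

definition weakly_thick :: "nat set \<Rightarrow> bool" where
  "weakly_thick F \<longleftrightarrow> (\<exists>k>0. thick {n. k * n \<in> F})"

definition F_wt :: "nat set set" where
  "F_wt = {F. weakly_thick F}"

definition block_family :: "nat set set \<Rightarrow> nat set set" where
  "block_family \<F> = {F. \<exists>F'\<in>\<F>. \<forall>W. finite W \<and> W \<subseteq> F' \<longrightarrow> (\<exists>m. (\<lambda>w. m + w) ` W \<subseteq> F)}"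

definition Trans_family :: "nat set set \<Rightarrow> 'a::metric_space set \<Rightarrow> ('a \<Rightarrow> 'a) \<Rightarrow> 'a set" where
  "Trans_family \<F> X T = {x \<in> X. \<forall>U. opene X U \<longrightarrow> hit_point T x U \<in> \<F>}"

definition point_transitive :: "nat set set \<Rightarrow> 'a::metric_space set \<Rightarrow> ('a \<Rightarrow> 'a) \<Rightarrow> bool" where
  "point_transitive \<F> X T \<longleftrightarrow> Trans_family \<F> X T \<noteq> {}"

end

theory Submission
  imports Defs
begin

text \<open>
  A set belongs to \<open>b\<F>\<^sub>w\<^sub>t\<close> iff, for one fixed \<open>k > 0\<close>, it contains arbitrarily long arithmetic
  progressions of difference \<open>k\<close>. Such sets are infinite, so \<open>b\<F>\<^sub>w\<^sub>t\<close>-transitive points are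
  transitive. If the orbit of \<open>x\<close> visits a small closed ball \<open>C\<close> along such progressions, then
  by compactness some point satisfies \<open>T\<^sup>i\<^sup>k y \<in> C\<close> for all \<open>i\<close>, and the closed set of all such points
  is mapped into itself by \<open>T\<^sup>k\<close>. Conversely, if \<open>Y \<subseteq> U\<close> and \<open>T\<^sup>k Y \<subseteq> Y\<close>, then a transitive point
  enters the open neighbourhood \<open>\<Inter>i\<le>n. T\<^sup>-\<^sup>i\<^sup>k U\<close> of \<open>Y\<close>, which gives progressions of any length.
\<close>

section \<open>Combinatorics of the block family\<close>

text \<open>A thick set of multiples supplies finite blocks \<open>k * a\<close>, ...,
  \<open>k * (a + n)\<close> in \<open>F'\<close>, whose translates lie in \<open>F\<close>.
  Conversely, the set of all multiples of \<open>k\<close> serves as \<open>F'\<close>.\<close>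

lemma block_family_F_wt_iff:
  "F \<in> block_family F_wt \<longleftrightarrow> (\<exists>k>0. \<forall>n. \<exists>m. \<forall>i\<le>n. m + i * k \<in> F)"
proof
  assume "F \<in> block_family F_wt"
  then obtain F' k where k: "k > 0" and thick: "thick {n. k * n \<in> F'}"
    and block: "\<And>W. finite W \<Longrightarrow> W \<subseteq> F' \<Longrightarrow> \<exists>m. (\<lambda>w. m + w) ` W \<subseteq> F"
    by (auto simp: block_family_def F_wt_def weakly_thick_def)
  have "\<exists>m. \<forall>i\<le>n. m + i * k \<in> F" for n
  proof -
    \<comment> \<open>\<open>Suc n\<close> because \<open>thick\<close> speaks of positive lengths
      only.\<close>
    obtain a where "{a..a + Suc n} \<subseteq> {n. k * n \<in> F'}"
      using thick unfolding thick_def by blast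
    then have "(\<lambda>i. k * (a + i)) ` {..n} \<subseteq> F'"
      by (auto simp: subset_iff)
    then obtain m where "(\<lambda>w. m + w) ` (\<lambda>i. k * (a + i)) ` {..n} \<subseteq> F"
      using block[of "(\<lambda>i. k * (a + i)) ` {..n}"] by blast
    then have "\<forall>i\<le>n. (m + k * a) + i * k \<in> F"
      by (auto simp: image_subset_iff algebra_simps)
    then show ?thesis by blast
  qed
  with k show "\<exists>k>0. \<forall>n. \<exists>m. \<forall>i\<le>n. m + i * k \<in> F" by blast
next
  assume "\<exists>k>0. \<forall>n. \<exists>m. \<forall>i\<le>n. m + i * k \<in> F"
  then obtain k where k: "k > 0" and prog: "\<And>n. \<exists>m. \<forall>i\<le>n. m + i * k \<in> F" by blast
  show "F \<in> block_family F_wt"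
    unfolding block_family_def
  proof (intro CollectI bexI allI impI)
    show "range (\<lambda>i. i * k) \<in> F_wt"
      unfolding F_wt_def weakly_thick_def thick_def
      using k by (auto intro!: exI[of _ k])
    fix W assume W: "finite W \<and> W \<subseteq> range (\<lambda>i. i * k)"
    \<comment> \<open>Since \<open>k > 0\<close>, the index of a multiple is at most the multiple
      itself, so the maximum bounds every index needed; inserting 0 covers empty
      \<open>W\<close>.\<close>
    obtain m where m: "\<forall>i\<le>Max (insert 0 W). m + i * k \<in> F" using prog by blast
    have "m + w \<in> F" if w: "w \<in> W" for w
    proof -
      obtain i where i: "w = i * k" using W w by blast
      have "i \<le> w" using k i by simp
      also have "w \<le> Max (insert 0 W)" using W w by simp
      finally show ?thesis using m i by blast
    qed
    then show "\<exists>m. (\<lambda>w. m + w) ` W \<subseteq> F" by blast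
  qed
qed

text \<open>A progression of \<open>card F + 1\<close> distinct terms cannot fit into a finite
  \<open>F\<close>.\<close>

lemma block_family_F_wt_imp_infinite:
  assumes "F \<in> block_family F_wt"
  shows "infinite F"
proof
  assume fin: "finite F"
  obtain k m where k: "k > 0" and m: "\<And>i. i \<le> card F \<Longrightarrow> m + i * k \<in> F"
    using assms unfolding block_family_F_wt_iff by blast
  have "inj_on (\<lambda>i. m + i * k) {..card F}" using k by (auto simp: inj_on_def)
  then have "card {..card F} \<le> card F"
    by (rule card_inj_on_le) (use m fin in auto)
  then show False by simp
qed

lemma opene_Int_ball: "z \<in> X \<Longrightarrow> e > 0 \<Longrightarrow> opene X (X \<inter> ball z e)"
  by (auto simp: opene_def openin_open_Int)

text \<open>The ball is closed because small periodic sets are later built by compactness inside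
  it.\<close>

lemma opene_contains_cball:
  assumes "opene X U"
  obtains z e where "z \<in> X" "e > 0" "X \<inter> cball z e \<subseteq> U"
proof -
  obtain S z where S: "open S" "U = X \<inter> S" and z: "z \<in> X" "z \<in> S"
    using assms unfolding opene_def openin_open by blast
  obtain e where "e > 0" "cball z e \<subseteq> S" using S z open_contains_cball by blast
  with S z that show thesis by blast
qed

lemma continuous_map_funpow:
  assumes "continuous_map A A f"
  shows "continuous_map A A (f ^^ n)"
proof (induction n)
  case (Suc n)
  then show ?case using continuous_map_compose[OF _ assms] by (simp add: o_def)
qed (simp add: id_def)

context
  fixes X :: "'a::metric_space set" and T :: "'a \<Rightarrow> 'a"
  assumes tds: "tds X T"
begin

lemma continuous_map_iterate: "continuous_map (top_of_set X) (top_of_set X) (T ^^ n)"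
  using tds by (intro continuous_map_funpow) (auto simp: tds_def continuous_map_in_subtopology)

lemma iterate_in: "x \<in> X \<Longrightarrow> (T ^^ n) x \<in> X"
  using continuous_map_image_subset_topspace[OF continuous_map_iterate] by auto

lemma openin_iterate_vimage:
  "openin (top_of_set X) U \<Longrightarrow> openin (top_of_set X) {x \<in> X. (T ^^ n) x \<in> U}"
  using openin_continuous_map_preimage[OF continuous_map_iterate] by simp

lemma closedin_iterate_vimage:
  "closedin (top_of_set X) C \<Longrightarrow> closedin (top_of_set X) {x \<in> X. (T ^^ n) x \<in> C}"
  using closedin_continuous_map_preimage[OF continuous_map_iterate] by simp

section \<open>Transitive points and transitivity\<close>

text \<open>A limit point is one whose every ball is visited at arbitrarily late times. The limit
  set never leaves \<open>X\<close>, since \<open>X\<close> is closed and contains the orbit, so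
  only the other inclusion matters.\<close>

lemma mem_Trans_iff:
  "x \<in> Trans X T \<longleftrightarrow> x \<in> X \<and> (\<forall>U. opene X U \<longrightarrow> infinite (hit_point T x U))"
proof (cases "x \<in> X")
  case x: True
  have "closed X" using tds by (simp add: tds_def compact_imp_closed)
  have "closure {(T ^^ n) x | n. 0 \<le> n} \<subseteq> X"
    using \<open>closed X\<close> iterate_in[OF x] by (intro closure_minimal) auto
  then have sub: "omega_limit T x \<subseteq> X"
    unfolding omega_limit_def by blast
  have omega: "y \<in> omega_limit T x \<longleftrightarrow> (\<forall>m. \<forall>e>0. \<exists>n\<ge>m. dist ((T ^^ n) x) y < e)" for y
    unfolding omega_limit_def by (fastforce simp: closure_approachable)
  have "X \<subseteq> omega_limit T x \<longleftrightarrow> (\<forall>U. opene X U \<longrightarrow> infinite (hit_point T x U))"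
  proof
    assume L: "X \<subseteq> omega_limit T x"
    show "\<forall>U. opene X U \<longrightarrow> infinite (hit_point T x U)"
    proof (intro allI impI)
      fix U assume "opene X U"
      then obtain z e where z: "z \<in> X" "e > 0" and U: "X \<inter> cball z e \<subseteq> U"
        by (rule opene_contains_cball)
      show "infinite (hit_point T x U)"
        unfolding infinite_nat_iff_unbounded_le
      proof
        fix m
        obtain n where "n \<ge> m" "dist ((T ^^ n) x) z < e" using L z omega by blast
        then have "(T ^^ n) x \<in> U" using U iterate_in[OF x] by (auto simp: dist_commute)
        with \<open>n \<ge> m\<close> show "\<exists>n\<ge>m. n \<in> hit_point T x U" by (auto simp: hit_point_def)
      qed
    qed
  next
    assume R: "\<forall>U. opene X U \<longrightarrow> infinite (hit_point T x U)"
    show "X \<subseteq> omega_limit T x"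
    proof (rule subsetI, unfold omega, intro allI impI)
      fix y m and e :: real assume "y \<in> X" "e > 0"
      then have "infinite (hit_point T x (X \<inter> ball y e))" using R opene_Int_ball by blast
      then obtain n where "n \<ge> m" "n \<in> hit_point T x (X \<inter> ball y e)"
        unfolding infinite_nat_iff_unbounded_le by blast
      then show "\<exists>n\<ge>m. dist ((T ^^ n) x) y < e" by (auto simp: hit_point_def dist_commute)
    qed
  qed
  with x sub show ?thesis by (auto simp: Trans_def)
qed (simp add: Trans_def)

lemma Trans_imp_transitive:
  assumes "x \<in> Trans X T"
  shows "transitive_tds X T"
  unfolding transitive_tds_def
proof (intro allI impI)
  fix U V assume U: "opene X U" and V: "opene X V"
  have x: "x \<in> X" and inf: "\<And>U. opene X U \<Longrightarrow> infinite (hit_point T x U)"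
    using assms by (auto simp: mem_Trans_iff)
  obtain n where n: "(T ^^ n) x \<in> U"
    using infinite_imp_nonempty[OF inf[OF U]] by (auto simp: hit_point_def)
  show "infinite (hit_sets X T U V)"
    unfolding infinite_nat_iff_unbounded_le
  proof
    fix m
    \<comment> \<open>The bound \<open>n + m\<close> makes \<open>l - n\<close>, the travel time
      from \<open>U\<close> to \<open>V\<close>, at least \<open>m\<close>.\<close>
    obtain l where l: "l \<ge> n + m" "(T ^^ l) x \<in> V"
      using inf[OF V] unfolding infinite_nat_iff_unbounded_le by (auto simp: hit_point_def)
    have "(T ^^ (l - n)) ((T ^^ n) x) = (T ^^ l) x"
      using l by (simp flip: funpow_add o_apply[of "T ^^ (l - n)"])
    then have "l - n \<in> hit_sets X T U V"
      using l n iterate_in[OF x] by (auto simp: hit_sets_def)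
    moreover have "l - n \<ge> m" using l by simp
    ultimately show "\<exists>k\<ge>m. k \<in> hit_sets X T U V" by blast
  qed
qed

text \<open>Baire category: a point visiting each ball of a countable base infinitely often is transitive.\<close>

lemma transitive_imp_Trans_nonempty:
  assumes trans: "transitive_tds X T"
  shows "Trans X T \<noteq> {}"
proof -
  have "compact X" "X \<noteq> {}" using tds by (auto simp: tds_def)
  have "\<exists>C. finite C \<and> C \<subseteq> X \<and> X \<subseteq> (\<Union>c\<in>C. ball c (inverse (Suc j)))" for j
  proof -
    have "X \<subseteq> (\<Union>c\<in>X. ball c (inverse (Suc j)))" by force
    then obtain C where "C \<subseteq> X" "finite C" "X \<subseteq> (\<Union>c\<in>C. ball c (inverse (Suc j)))"
      using compactE_image[OF \<open>compact X\<close>, of X "\<lambda>c. ball c (inverse (Suc j))"] open_ball by metis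
    then show ?thesis by blast
  qed
  then obtain C where C: "\<And>j. finite (C j)" "\<And>j. C j \<subseteq> X"
    and cover: "\<And>j. X \<subseteq> (\<Union>c\<in>C j. ball c (inverse (Suc j)))"
    by metis
  \<comment> \<open>An index is a ball around a point of one of the finite nets together with a
    lower bound \<open>m\<close> on visiting times. Each \<open>G i\<close> is open by continuity
    and dense because hitting time sets are infinite.\<close>
  define I where "I = (SIGMA j:UNIV. C j) \<times> (UNIV :: nat set)"
  define G where "G = (\<lambda>((j, c), m). \<Union>n\<in>{m..}. {x \<in> X. (T ^^ n) x \<in> X \<inter> ball c (inverse (Suc j))})"
  have "countable I" unfolding I_def using C by (auto intro!: countable_SIGMA intro: countable_finite)
  have "openin (top_of_set X) (G i) \<and> top_of_set X closure_of (G i) = topspace (top_of_set X)"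
    if "i \<in> I" for i
  proof -
    obtain j c m where i: "i = ((j, c), m)" "c \<in> C j"
      using \<open>i \<in> I\<close> by (auto simp: I_def)
    have B: "opene X (X \<inter> ball c (inverse (Suc j)))"
      using i C by (intro opene_Int_ball) auto
    have "openin (top_of_set X) (G i)"
      unfolding G_def i prod.case
      using openin_iterate_vimage B unfolding opene_def by blast
    moreover have "G i \<inter> U \<noteq> {}" if "openin (top_of_set X) U" "U \<noteq> {}" for U
    proof -
      have "infinite (hit_sets X T U (X \<inter> ball c (inverse (Suc j))))"
        using trans B that by (simp add: transitive_tds_def opene_def)
      then obtain n where "n \<ge> m" "n \<in> hit_sets X T U (X \<inter> ball c (inverse (Suc j)))"
        unfolding infinite_nat_iff_unbounded_le by blast
      then show ?thesis unfolding hit_sets_def G_def i by fastforce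
    qed
    ultimately show ?thesis unfolding dense_intersects_open by blast
  qed
  then have "top_of_set X closure_of \<Inter>(G ` I) = topspace (top_of_set X)"
    using \<open>compact X\<close> \<open>countable I\<close>
    by (intro Baire_category)
      (auto intro!: compact_imp_locally_compact_space compact_space_subtopology
        regular_space_subtopology regular_space_euclidean)
  with \<open>X \<noteq> {}\<close> have "\<Inter>(G ` I) \<noteq> {}" by (metis closure_of_empty topspace_euclidean_subtopology)
  then obtain x where x: "\<And>i. i \<in> I \<Longrightarrow> x \<in> G i" by blast
  have visit: "\<exists>n\<ge>m. (T ^^ n) x \<in> X \<inter> ball c (inverse (Suc j))" if "c \<in> C j" for j c m
    using x[of "((j, c), m)"] that by (auto simp: I_def G_def)
  \<comment> \<open>Every \<open>G i\<close> lies in \<open>X\<close>, so one concrete index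
    suffices to place \<open>x\<close> in \<open>X\<close>.\<close>
  obtain z where "z \<in> X" using \<open>X \<noteq> {}\<close> by blast
  then obtain c0 where "c0 \<in> C 0" using cover by blast
  then have "x \<in> X" using x[of "((0, c0), 0)"] by (auto simp: I_def G_def)
  moreover have "infinite (hit_point T x U)" if "opene X U" for U
    unfolding infinite_nat_iff_unbounded_le
  proof
    fix m
    obtain z e where z: "z \<in> X" "e > 0" and U: "X \<inter> cball z e \<subseteq> U"
      using \<open>opene X U\<close> by (rule opene_contains_cball)
    \<comment> \<open>Half of \<open>e\<close>, as \<open>z\<close> and the visiting point are
      compared through the centre \<open>c\<close>.\<close>
    obtain j where j: "inverse (real (Suc j)) < e / 2"
      using reals_Archimedean[of "e / 2"] z by auto
    obtain c where c: "c \<in> C j" "dist c z < inverse (Suc j)"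
      using cover[of j] z by (auto simp: subset_iff)
    obtain n where n: "n \<ge> m" "(T ^^ n) x \<in> X" "dist c ((T ^^ n) x) < inverse (Suc j)"
      using visit[OF c(1)] by auto
    have "dist z ((T ^^ n) x) \<le> dist c z + dist c ((T ^^ n) x)" by (metis dist_commute dist_triangle)
    then have "dist z ((T ^^ n) x) \<le> e" using c n j by linarith
    then show "\<exists>n\<ge>m. n \<in> hit_point T x U" using U n by (auto simp: hit_point_def)
  qed
  ultimately show ?thesis using mem_Trans_iff by blast
qed

section \<open>Small periodic sets and progressions of visiting times\<close>

lemma Trans_family_subset_Trans: "Trans_family (block_family F_wt) X T \<subseteq> Trans X T"
  by (auto simp: Trans_family_def mem_Trans_iff block_family_F_wt_imp_infinite)

lemma Trans_subset_Trans_family: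
  assumes dense: "dense_small_periodic_sets X T"
  shows "Trans X T \<subseteq> Trans_family (block_family F_wt) X T"
proof
  fix x assume "x \<in> Trans X T"
  then have x: "x \<in> X" and inf: "\<And>U. opene X U \<Longrightarrow> infinite (hit_point T x U)"
    by (auto simp: mem_Trans_iff)
  have "hit_point T x U \<in> block_family F_wt" if U: "opene X U" for U
  proof -
    obtain Y k where "Y \<noteq> {}" "Y \<subseteq> U" "k > 0" and Y: "(T ^^ k) ` Y \<subseteq> Y"
      using dense U unfolding dense_small_periodic_sets_def by metis
    have "U \<subseteq> X" using U by (auto simp: opene_def dest: openin_imp_subset)
    have inv: "(T ^^ (i * k)) y \<in> Y" if "y \<in> Y" for i y
      using that Y by (induction i) (auto simp: funpow_add)
    have "\<exists>m. \<forall>i\<le>n. m + i * k \<in> hit_point T x U" for n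
    proof -
      \<comment> \<open>Even if \<open>Y\<close> has empty interior, \<open>W\<close> is an opene
        set containing it; a single visit to \<open>W\<close> at time \<open>m\<close> yields the
        whole progression.\<close>
      define W where "W = (\<Inter>i\<in>{..n}. {z \<in> X. (T ^^ (i * k)) z \<in> U})"
      have "openin (top_of_set X) W"
        unfolding W_def using U
        by (intro openin_INT2 openin_iterate_vimage) (auto simp: opene_def)
      moreover have "Y \<subseteq> W"
        using inv \<open>Y \<subseteq> U\<close> \<open>U \<subseteq> X\<close> by (auto simp: W_def)
      ultimately have "opene X W" using \<open>Y \<noteq> {}\<close> by (auto simp: opene_def)
      then obtain m where "(T ^^ m) x \<in> W"
        using infinite_imp_nonempty[OF inf] by (auto simp: hit_point_def)
      then have "\<forall>i\<le>n. m + i * k \<in> hit_point T x U"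
        by (auto simp: W_def hit_point_def funpow_add add.commute[of m])
      then show ?thesis by blast
    qed
    with \<open>k > 0\<close> show ?thesis by (auto simp: block_family_F_wt_iff)
  qed
  with x show "x \<in> Trans_family (block_family F_wt) X T" by (simp add: Trans_family_def)
qed

lemma Trans_family_imp_dense_small_periodic_sets:
  assumes "x \<in> Trans_family (block_family F_wt) X T"
  shows "dense_small_periodic_sets X T"
  unfolding dense_small_periodic_sets_def
proof (intro allI impI)
  fix U assume "opene X U"
  then obtain z e where z: "z \<in> X" "e > 0" and U: "X \<inter> cball z e \<subseteq> U"
    by (rule opene_contains_cball)
  define C where "C = X \<inter> cball z e"
  have C: "closedin (top_of_set X) C" by (simp add: C_def closedin_closed_Int)
  have x: "x \<in> X" and "hit_point T x (X \<inter> ball z e) \<in> block_family F_wt"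
    using assms opene_Int_ball[OF z] by (auto simp: Trans_family_def)
  then obtain k where "k > 0" and prog: "\<And>n. \<exists>m. \<forall>i\<le>n. (T ^^ (m + i * k)) x \<in> X \<inter> ball z e"
    by (auto simp: block_family_F_wt_iff hit_point_def)
  \<comment> \<open>The closed sets \<open>D n\<close> decrease, and each contains an orbit point of
    \<open>x\<close> starting a progression of visits. Their intersection will be the periodic set;
    lying in \<open>D 0\<close>, it lies in \<open>C\<close>.\<close>
  define D where "D n = (\<Inter>i\<in>{..n}. {y \<in> X. (T ^^ (i * k)) y \<in> C})" for n
  have closed: "closedin (top_of_set X) (D n)" for n
    unfolding D_def by (intro closedin_INT closedin_iterate_vimage C) auto
  have "D n \<noteq> {}" for n
  proof -
    obtain m where "\<forall>i\<le>n. (T ^^ (m + i * k)) x \<in> X \<inter> ball z e" using prog by blast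
    then have "(T ^^ m) x \<in> D n"
      using iterate_in[OF x] by (auto simp: D_def C_def funpow_add add.commute[of m])
    then show ?thesis by blast
  qed
  moreover have "compact_space (top_of_set X)"
    using tds by (simp add: tds_def compact_space_subtopology)
  moreover have "decseq D" by (auto simp: decseq_def D_def)
  ultimately have "(\<Inter>n. D n) \<noteq> {}" using closed by (intro compact_space_imp_nest)
  moreover have "closedin (top_of_set X) (\<Inter>n. D n)" using closed by (intro closedin_INT) auto
  moreover have "(\<Inter>n. D n) \<subseteq> U"
  proof
    fix y assume "y \<in> (\<Inter>n. D n)"
    then have "y \<in> D 0" by blast
    then show "y \<in> U" using U by (simp add: D_def C_def subset_iff)
  qed
  moreover have "(T ^^ k) ` (\<Inter>n. D n) \<subseteq> (\<Inter>n. D n)"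
  proof clarify
    fix y n assume y: "y \<in> (\<Inter>n. D n)"
    \<comment> \<open>Condition \<open>i\<close> on the image of \<open>y\<close> is condition
      \<open>Suc i\<close> on \<open>y\<close>.\<close>
    have "(T ^^ (i * k)) ((T ^^ k) y) \<in> C" for i
    proof -
      have "y \<in> D (Suc i)" using y by blast
      then have "(T ^^ (Suc i * k)) y \<in> C" unfolding D_def by blast
      then show ?thesis by (simp add: funpow_add add.commute[of k])
    qed
    moreover have "y \<in> D 0" using y by blast
    ultimately show "(T ^^ k) y \<in> D n" using iterate_in by (auto simp: D_def)
  qed
  ultimately show "\<exists>Y k. Y \<noteq> {} \<and> closedin (top_of_set X) Y \<and> Y \<subseteq> U \<and> 0 < k \<and> (T ^^ k) ` Y \<subseteq> Y"
    using \<open>k > 0\<close> by blast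
qed

end

theorem theorem4p2:
  fixes X :: "'a::metric_space set" and T :: "'a \<Rightarrow> 'a"
  assumes "tds X T"
  shows "(transitive_tds X T \<and> dense_small_periodic_sets X T \<longleftrightarrow>
            Trans_family (block_family F_wt) X T = Trans X T \<and> Trans X T \<noteq> {})
       \<and> (Trans_family (block_family F_wt) X T = Trans X T \<and> Trans X T \<noteq> {} \<longleftrightarrow>
            point_transitive (block_family F_wt) X T)"
  \<comment> \<open>The conditions are linked in a cycle: the Baire argument and both inclusions
    give the equality, nonemptiness gives point transitivity, and one such point gives back
    transitivity and the small periodic sets.\<close>
  using transitive_imp_Trans_nonempty[OF assms] Trans_imp_transitive[OF assms]
    Trans_family_subset_Trans[OF assms] Trans_subset_Trans_family[OF assms]
    Trans_family_imp_dense_small_periodic_sets[OF assms]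
  unfolding point_transitive_def by blast

end
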